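(* For $|q|<1$, $$\sum_{m,k,n\geq0} \frac{q^{T(m)+T(m+k)+n^2}}{(q)_m(q)_k}\begin{bmatrix} \lfloor k/2\rfloor\\ n\end{bmatrix}_q=\frac{(q^{21},q^8,q^{13};q^{21})_\infty}{(q)_\infty}.$$
   Context: For $m$ a nonnegative integer, $(a)_m=(a;q)_m=\prod_{j=0}^{m-1}(1-aq^j)$ (with $(a)_0=1$), $(a;q)_\infty=\prod_{j\ge0}(1-aq^j)$, $(q)_\infty=(q;q)_\infty$, and $(a_1,\ldots,a_r;q)_\infty=(a_1;q)_\infty\cdots(a_r;q)_\infty$. In particular $(q)_m=\prod_{j=1}^m(1-q^j)$. The $q$-binomial coefficient is $\begin{bmatrix} m+n\\ m\end{bmatrix}_q=\frac{(q)_{m+n}}{(q)_m(q)_n}$ if $m,n$ are nonnegative integers, and it is $0$ otherwise (so $\begin{bmatrix} A\\ B\end{bmatrix}_q=0$ unless $0\le B\le A$). $T(j)=\frac{j(j+1)}{2}$. *)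

theory Defs
  imports "HOL-Analysis.Analysis"
begin

definition q_pochhammer :: "complex \<Rightarrow> complex \<Rightarrow> nat \<Rightarrow> complex" where
  "q_pochhammer a q m = (\<Prod>j<m. 1 - a * q ^ j)"

definition q_pochhammer_inf :: "complex \<Rightarrow> complex \<Rightarrow> complex" where
  "q_pochhammer_inf a q = (\<Prod>j. 1 - a * q ^ j)"

definition q_pochhammer_inf_list :: "complex list \<Rightarrow> complex \<Rightarrow> complex" where
  "q_pochhammer_inf_list as q = (\<Prod>a\<leftarrow>as. q_pochhammer_inf a q)"

definition q_binomial :: "complex \<Rightarrow> nat \<Rightarrow> nat \<Rightarrow> complex" where
  "q_binomial q A B =
     (if B \<le> A
      then q_pochhammer q q A / (q_pochhammer q q B * q_pochhammer q q (A - B))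
      else 0)"

definition T :: "nat \<Rightarrow> nat" where
  "T j = j * (j + 1) div 2"

text \<open>For \<open>norm q < 1\<close> the infinite products converge, so that \<^const>\<open>prodinf\<close> is their
  limit.\<close>

lemma convergent_prod_q_pochhammer:
  fixes a q :: complex
  assumes "norm q < 1"
  shows "convergent_prod (\<lambda>j. 1 - a * q ^ j)"
proof -
  have "summable (\<lambda>j. norm (- (a * q ^ j)))"
    using assms by (simp add: norm_mult norm_power summable_mult summable_geometric)
  then have "abs_convergent_prod (\<lambda>j. 1 + - (a * q ^ j))"
    by (simp add: summable_imp_abs_convergent_prod)
  then show ?thesis
    by (simp add: abs_convergent_prod_imp_convergent_prod)
qed

end

(* Write r(k) = 1/(q)_k, with r(k) = 0 for k < 0, and tri(j) = j(j+1)/2 for integers j. Bressoud's finite form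
   of the Rogers-Ramanujan identity, for k = 2N and k = 2N+1 alike,
     sum_n q^(n^2) [N; n] = (q)_k sum_j (-1)^j q^(5 tri(j) - 2j) r(N - 2j) r(k - N + 2j),
   removes the q-binomial. For fixed j the remaining sum over m and k splits by the parity of k into
   F(4j) + F(4j+1), where F(d) = sum_{m,a} q^(tri(m) + tri(m+2a+d)) r(m) r(a) r(a+d). Summing over m + a = s first,
   q-Vandermonde gives F(d) = sum_s q^(tri(s) + tri(s+d)) r(s) r(s+d), and Durfee rectangles then give
   F(d) + F(d+1) = q^tri(d) / (q)_inf. What is left is sum_j (-1)^j q^(21 tri(j) - 8j) / (q)_inf, which is evaluated
   by Jacobi's triple product. *)

theory Submission imports Defs begin

section \<open>Unordered sums\<close>

text \<open>The floor in the q-binomial is what lets the two parities of k meet. For k = 2N + i, the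
  substitution a = N - 2j turns Bressoud's two factors into \<open>r a\<close> and
  \<open>r (a + 4 * j + i)\<close>, and k into 2a + 4j + i, so the parities give pair sums with the
  consecutive parameters 4j and 4j + 1. Their sum collapses because a shift of s by one gives F(d +
  1) the same factor r(s + d) as F(d).

  Extending r by zero lets every index run over all integers: shifts and reflections create no
  boundary terms, and a parameter such as d = 4j may be negative. The price is negative powers of q,
  hence the assumption \<open>q \<noteq> 0\<close> in the locale \<open>q_series\<close>. Passing
  from a finite identity to an infinite one (q-Vandermonde to Durfee, finite to full triple product)
  is dominated convergence with all \<open>r k\<close> bounded by one constant.\<close>

lemma summable_on_times_prod:
  fixes f :: "'a \<Rightarrow> real" and g :: "'b \<Rightarrow> real"
  assumes f: "f summable_on A" "\<And>x. x \<in> A \<Longrightarrow> 0 \<le> f x"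
    and g: "g summable_on B" "\<And>y. y \<in> B \<Longrightarrow> 0 \<le> g y"
  shows "(\<lambda>(x, y). f x * g y) summable_on A \<times> B"
proof (rule summable_on_SigmaI)
  show "((\<lambda>y. case (x, y) of (x, y) \<Rightarrow> f x * g y) has_sum f x * infsum g B) B" for x
    using has_sum_cmult_right[OF has_sum_infsum[OF g(1)]] by simp
  show "(\<lambda>x. f x * infsum g B) summable_on A"
    using f(1) by (rule summable_on_cmult_left)
qed (use f g in auto)

text \<open>Dominated convergence for unordered sums. The Weierstrass M-test makes the finite
  partial sums converge uniformly in \<open>n\<close>, so the limit in \<open>n\<close> and the
  limit over finite subsets can be exchanged.\<close>

lemma tannery_has_sum:
  fixes f :: "nat \<Rightarrow> 'a \<Rightarrow> 'b :: banach"
  assumes f: "\<And>n. (f n has_sum s n) A"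
    and bound: "\<And>n x. x \<in> A \<Longrightarrow> norm (f n x) \<le> h x"
    and h: "h summable_on A"
    and lim: "\<And>x. x \<in> A \<Longrightarrow> (\<lambda>n. f n x) \<longlonglongrightarrow> g x"
    and s: "s \<longlonglongrightarrow> l"
  shows "(g has_sum l) A"
proof -
  have "norm (g x) \<le> h x" if "x \<in> A" for x
    using lim[OF that] bound[OF that] by (intro LIMSEQ_le_const2[OF tendsto_norm]) auto
  with h have "(\<lambda>x. norm (g x)) summable_on A"
    by (rule Infinite_Sum.abs_summable_on_comparison_test')
  then have g: "(g has_sum infsum g A) A"
    by (rule has_sum_infsum[OF abs_summable_summable])
  have "uniform_limit UNIV (\<lambda>X n. \<Sum>x\<in>X. f n x) s (finite_subsets_at_top A)"
    using bound f h by (intro Weierstrass_m_test_general') auto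
  moreover have "\<forall>\<^sub>F X in finite_subsets_at_top A. (\<lambda>n. \<Sum>x\<in>X. f n x) \<longlonglongrightarrow> (\<Sum>x\<in>X. g x)"
    using eventually_finite_subsets_at_top_weakI by (rule eventually_mono) (auto intro!: tendsto_sum lim)
  ultimately have "s \<longlonglongrightarrow> infsum g A"
    using g[unfolded has_sum_def] swap_uniform_limit'[of _ "\<lambda>X. \<Sum>x\<in>X. g x" sequentially "finite_subsets_at_top A" _ UNIV s]
    by simp
  with s have "l = infsum g A"
    by (rule LIMSEQ_unique)
  with g show ?thesis
    by simp
qed

lemma has_sum_shift_int:
  fixes f :: "int \<Rightarrow> 'a :: {comm_monoid_add, topological_space}"
  shows "((\<lambda>k. f (k + c)) has_sum s) UNIV \<longleftrightarrow> (f has_sum s) UNIV"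
  by (rule has_sum_reindex_bij_witness[of _ "\<lambda>k. k - c" "\<lambda>k. k + c"]) auto

lemma has_sum_reflect_int:
  fixes f :: "int \<Rightarrow> 'a :: {comm_monoid_add, topological_space}"
  shows "((\<lambda>k. f (c - k)) has_sum s) UNIV \<longleftrightarrow> (f has_sum s) UNIV"
  by (rule has_sum_reindex_bij_witness[of _ "\<lambda>k. c - k" "\<lambda>k. c - k"]) auto

lemma summable_on_int_supportI:
  fixes f :: "int \<Rightarrow> 'a :: {comm_monoid_add, topological_space}"
  assumes "\<And>k. f k \<noteq> 0 \<Longrightarrow> a \<le> k \<and> k \<le> b"
  shows "f summable_on UNIV"
proof (rule finite_nonzero_values_imp_summable_on)
  have "{k \<in> UNIV. f k \<noteq> 0} \<subseteq> {a..b}"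
    using assms by auto
  then show "finite {k \<in> UNIV. f k \<noteq> 0}"
    by (rule finite_subset) simp
qed

section \<open>Triangular numbers and reciprocal \<open>q\<close>-factorials\<close>

definition tri :: "int \<Rightarrow> int" where
  "tri j = j * (j + 1) div 2"

text \<open>With the division cleared, the exponent identities below become polynomial identities
  over the integers.\<close>

lemma two_tri: "2 * tri j = j * (j + 1)"
  unfolding tri_def by simp

lemma tri_0 [simp]: "tri 0 = 0"
  by (simp add: tri_def)

lemma tri_1 [simp]: "tri 1 = 1"
  by (simp add: tri_def)

lemma tri_minus_1 [simp]: "tri (- 1) = 0"
  by (simp add: tri_def)

lemma tri_add: "tri (a + b) = tri a + tri b + a * b"
  using two_tri[of "a + b"] two_tri[of a] two_tri[of b] by (simp add: algebra_simps)

lemma tri_minus: "tri (- a) = tri a - a"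
  using two_tri[of "- a"] two_tri[of a] by (simp add: algebra_simps)

lemma tri_diff: "tri (a - b) = tri a + tri b - b - a * b"
  using two_tri[of "a - b"] two_tri[of a] two_tri[of b] by (simp add: algebra_simps)

lemma tri_of_nat: "tri (int n) = int (T n)"
  unfolding tri_def T_def by (simp add: zdiv_int algebra_simps)

lemma tri_nonneg: "0 \<le> tri j"
proof -
  have "0 \<le> j * (j + 1)"
    by (cases "0 \<le> j") (auto intro: mult_nonpos_nonpos)
  then show ?thesis
    unfolding tri_def by simp
qed

lemma tri_ge: "j \<le> tri j"
  using tri_nonneg[of "j - 1"] tri_diff[of j 1] by (simp add: tri_def)

lemma T_ge: "n \<le> T n"
  using tri_ge[of "int n"] by (simp add: tri_of_nat)

definition inv_qfact :: "complex \<Rightarrow> int \<Rightarrow> complex" where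
  "inv_qfact q k = (if k < 0 then 0 else inverse (q_pochhammer q q (nat k)))"

lemma q_pochhammer_0 [simp]: "q_pochhammer a q 0 = 1"
  by (simp add: q_pochhammer_def)

lemma q_pochhammer_Suc: "q_pochhammer a q (Suc n) = q_pochhammer a q n * (1 - a * q ^ n)"
  by (simp add: q_pochhammer_def)

lemma q_pochhammer_LIMSEQ:
  assumes "norm q < 1"
  shows "(\<lambda>n. q_pochhammer a q n) \<longlonglongrightarrow> q_pochhammer_inf a q"
  unfolding q_pochhammer_def q_pochhammer_inf_def
  using convergent_prod_q_pochhammer[OF assms] by (intro has_prod_imp_tendsto' convergent_prod_has_prod)

locale q_series =
  fixes q :: complex
  assumes q_nz: "q \<noteq> 0" and norm_q: "norm q < 1"
begin

abbreviation r :: "int \<Rightarrow> complex" where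
  "r \<equiv> inv_qfact q"

abbreviation qf :: "nat \<Rightarrow> complex" where
  "qf \<equiv> q_pochhammer q q"

abbreviation qinf :: complex where
  "qinf \<equiv> q_pochhammer_inf q q"

lemma q_powi_add: "q powi (a + b) = q powi a * q powi b"
  by (rule power_int_add) (simp add: q_nz)

lemma q_power_neq_1 [simp]: "q * q ^ n \<noteq> 1"
proof -
  have "norm (q ^ Suc n) < 1"
    using norm_q by (simp add: norm_power power_less_one_iff del: power_Suc)
  then show ?thesis
    by auto
qed

lemma one_minus_q_powi_nz: "1 \<le> k \<Longrightarrow> 1 - q powi k \<noteq> 0"
  using q_power_neq_1[of "nat (k - 1)"]
  by (simp add: power_int_nonneg_exp nat_diff_distrib flip: power_Suc)

lemma qf_nz [simp]: "qf n \<noteq> 0"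
  by (simp add: q_pochhammer_def)

lemma qinf_nz [simp]: "qinf \<noteq> 0"
  unfolding q_pochhammer_inf_def
  by (rule prodinf_nonzero) (simp_all add: convergent_prod_q_pochhammer norm_q)

lemma r_neg [simp]: "k < 0 \<Longrightarrow> r k = 0"
  by (simp add: inv_qfact_def)

lemma r_of_nat [simp]: "r (int n) = inverse (qf n)"
  by (simp add: inv_qfact_def)

lemma r_0 [simp]: "r 0 = 1"
  by (simp add: inv_qfact_def)

text \<open>True for every integer: at \<open>k = 0\<close> the factor \<open>1 - q powi 0\<close>
  vanishes, and below that both sides are zero. All recurrences rest on this absence of an
  exceptional index.\<close>

lemma r_diff_1: "r (k - 1) = (1 - q powi k) * r k"
proof (cases "k \<ge> 1")
  case True
  define n where "n = nat (k - 1)"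
  have k: "k = int (Suc n)"
    using True by (simp add: n_def)
  have "r (k - 1) = inverse (qf n)"
    by (simp add: k)
  also have "\<dots> = (1 - q * q ^ n) * inverse (qf (Suc n))"
    using q_power_neq_1[of n] by (simp add: q_pochhammer_Suc field_simps)
  also have "\<dots> = (1 - q powi k) * r k"
    unfolding k r_of_nat power_int_of_nat by simp
  finally show ?thesis .
qed (cases "k = 0"; simp)

text \<open>The q-Pascal rule for the q-binomial [n; k] after division by (q)_(n-1), from the
  splitting 1 - q^n = q^k (1 - q^(n-k)) + (1 - q^k). The dual rule \<open>r_pascal2\<close> comes
  from 1 - q^n = (1 - q^(n-k)) + q^(n-k) (1 - q^k).\<close>

lemma r_pascal1:
  "(1 - q powi n) * (r k * r (n - k)) = q powi k * (r k * r (n - k - 1)) + r (k - 1) * r (n - k)"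
proof -
  have "q powi n = q powi k * q powi (n - k)"
    using q_nz by (simp flip: power_int_add)
  then show ?thesis
    unfolding r_diff_1 by (simp add: algebra_simps)
qed

lemma r_pascal2:
  "(1 - q powi n) * (r k * r (n - k)) = r k * r (n - k - 1) + q powi (n - k) * (r (k - 1) * r (n - k))"
proof -
  have "q powi n = q powi k * q powi (n - k)"
    using q_nz by (simp flip: power_int_add)
  then show ?thesis
    unfolding r_diff_1 by (simp add: algebra_simps)
qed

lemma r_LIMSEQ: "(\<lambda>n. r (int n + k)) \<longlonglongrightarrow> inverse qinf"
proof -
  have "(\<lambda>n. inverse (qf n)) \<longlonglongrightarrow> inverse qinf"
    by (intro tendsto_inverse q_pochhammer_LIMSEQ norm_q qinf_nz)
  moreover have "filterlim (\<lambda>n. nat (int n + k)) at_top sequentially"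
    unfolding filterlim_at_top eventually_sequentially
    by (metis le_nat_iff nat_le_iff add.commute diff_le_eq of_nat_le_iff order_trans nat_int_comparison(3) nat_mono)
  ultimately have "(\<lambda>n. inverse (qf (nat (int n + k)))) \<longlonglongrightarrow> inverse qinf"
    by (rule filterlim_compose)
  then show ?thesis
  proof (rule Lim_transform_eventually)
    show "\<forall>\<^sub>F n in sequentially. inverse (qf (nat (int n + k))) = r (int n + k)"
      using eventually_ge_at_top[of "nat (- k)"] by eventually_elim (auto simp: inv_qfact_def)
  qed
qed

lemma norm_r_bound:
  obtains C where "C > 0" "\<And>k. norm (r k) \<le> C"
proof -
  have "Bseq (\<lambda>n. r (int n + 0))"
    using r_LIMSEQ by (intro convergent_imp_Bseq convergentI)
  then obtain C where "C > 0" and C: "\<And>n. norm (r (int n)) \<le> C"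
    by (auto simp: Bseq_def simp del: r_of_nat)
  have "norm (r k) \<le> C" for k
    using C[of "nat k"] \<open>C > 0\<close> by (cases "k < 0") auto
  with \<open>C > 0\<close> show ?thesis
    by (rule that)
qed

lemma summable_norm_q_abs: "(\<lambda>k. norm q ^ nat \<bar>k\<bar>) summable_on (UNIV :: int set)"
proof -
  have nat: "(\<lambda>n. norm q ^ n) summable_on (UNIV :: nat set)"
    using norm_q by (simp add: summable_on_UNIV_nonneg_real_iff)
  have "(\<lambda>k. norm q ^ nat \<bar>k\<bar>) summable_on {0::int..}"
    by (rule summable_on_reindex_bij_witness[THEN iffD1, OF _ _ _ _ _ nat, of nat int]) auto
  moreover have "(\<lambda>k. norm q ^ nat \<bar>k\<bar>) summable_on {..0::int}"
    by (rule summable_on_reindex_bij_witness[THEN iffD1, OF _ _ _ _ _ nat, of "\<lambda>k. nat (- k)" "\<lambda>n. - int n"]) auto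
  moreover have "{0..} \<union> {..0} = (UNIV :: int set)"
    by auto
  ultimately show ?thesis
    using summable_on_union[of _ "{0::int..}" "{..0}"] by metis
qed

section \<open>\<open>q\<close>-Vandermonde and Durfee rectangles\<close>

text \<open>The same two series \<open>A\<close> and \<open>B\<close> are added in two ways. Index
  by index they give the sum for \<open>n\<close> and \<open>d + 1\<close>; with \<open>B\<close>
  shifted by one they give \<open>1 - q powi (n + 1)\<close> times the sum for \<open>n + 1\<close>
  and \<open>d\<close>. Hence the induction needs \<open>d\<close> arbitrary.\<close>

lemma q_vandermonde_nat:
  "((\<lambda>a. q powi (a * (a + d)) * (r (int n - a) * r a * r (a + d))) has_sum r (int n) * r (int n + d)) UNIV"
proof (induction n arbitrary: d)
  case 0
  show ?case
  proof (rule has_sum_finite_neutralI[of "{0}"])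
    fix a :: int
    assume "a \<in> UNIV - {0}"
    then have "a < 0 \<or> int 0 - a < 0"
      by auto
    then show "q powi (a * (a + d)) * (r (int 0 - a) * r a * r (a + d)) = 0"
      by auto
  qed auto
next
  case (Suc n)
  define A where "A a = q powi (a * (a + d) + a) * (r (int n - a) * r a * r (a + d))" for a
  define B where "B a = q powi ((a + 1) * (a + 1 + d)) * (r (int n - a) * r a * r (a + d + 1))" for a
  have supp: "0 \<le> a \<and> a \<le> int n" if "r (int n - a) * r a \<noteq> 0" for a
    using that by (metis diff_ge_0_iff_ge leI mult_eq_0_iff r_neg)
  have "A summable_on UNIV" "B summable_on UNIV"
    unfolding A_def B_def by (rule summable_on_int_supportI[of _ 0 "int n"], use supp in auto)+
  then obtain s t where s: "(A has_sum s) UNIV" and t: "(B has_sum t) UNIV"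
    by (auto simp: summable_on_def)
  have eq1: "A a + B a = q powi (a * (a + (d + 1))) * (r (int n - a) * r a * r (a + (d + 1)))" for a
  proof -
    have 1: "q powi ((a + 1) * (a + 1 + d)) = q powi (a * (a + (d + 1))) * q powi (a + d + 1)"
      using q_nz by (simp flip: power_int_add add: algebra_simps)
    have 2: "r (a + d) = (1 - q powi (a + d + 1)) * r (a + d + 1)"
      using r_diff_1[of "a + d + 1"] by simp
    have 3: "q powi (a * (a + d) + a) = q powi (a * (a + (d + 1)))"
      by (simp add: algebra_simps)
    show ?thesis
      unfolding A_def B_def 1 2 3 by (simp add: algebra_simps)
  qed
  have st: "s + t = r (int n) * r (int n + 1 + d)"
    using has_sum_unique[OF has_sum_add[OF s t, unfolded eq1] Suc.IH[of "d + 1"]]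
    by (simp add: add_ac del: r_of_nat)
  have eq2: "A a + B (a - 1)
    = (1 - q powi (int n + 1)) * (q powi (a * (a + d)) * (r (int (Suc n) - a) * r a * r (a + d)))" for a
  proof -
    have "A a + B (a - 1) = q powi (a * (a + d)) * r (a + d) *
        (q powi a * (r a * r (int n + 1 - a - 1)) + r (a - 1) * r (int n + 1 - a))"
      using q_nz unfolding A_def B_def by (simp add: power_int_add algebra_simps)
    also have "\<dots> = q powi (a * (a + d)) * r (a + d) * ((1 - q powi (int n + 1)) * (r a * r (int n + 1 - a)))"
      by (simp only: r_pascal1)
    finally show ?thesis
      by (simp add: algebra_simps)
  qed
  have "((\<lambda>a. B (a - 1)) has_sum t) UNIV"
    using t has_sum_shift_int[of B "- 1"] by simp
  from has_sum_add[OF s this] have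
    "((\<lambda>a. (1 - q powi (int n + 1)) * (q powi (a * (a + d)) * (r (int (Suc n) - a) * r a * r (a + d))))
      has_sum (r (int n) * r (int n + 1 + d))) UNIV"
    unfolding eq2 st .
  moreover have "r (int n) * r (int n + 1 + d)
      = (1 - q powi (int n + 1)) * (r (int (Suc n)) * r (int (Suc n) + d))"
    using r_diff_1[of "int (Suc n)"] by (simp add: add_ac del: r_of_nat)
  ultimately show ?case
    using one_minus_q_powi_nz[of "int n + 1"] by (simp add: has_sum_cmult_right_iff del: r_of_nat)
qed

lemma q_vandermonde:
  "((\<lambda>a. q powi (a * (a + d)) * (r (s - a) * r a * r (a + d))) has_sum r s * r (s + d)) UNIV"
proof (cases "s \<ge> 0")
  case True
  then show ?thesis
    using q_vandermonde_nat[of d "nat s"] by simp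
next
  case False
  then have "q powi (a * (a + d)) * (r (s - a) * r a * r (a + d)) = 0" for a
    by (cases "a < 0") auto
  moreover have "r s * r (s + d) = 0"
    using False by simp
  ultimately show ?thesis
    by (simp only: has_sum_0_simp)
qed

section \<open>The pair sums over m and a\<close>

lemma summable_pair_sum:
  "(\<lambda>(m, a). q powi (tri m + tri (m + 2 * a + d)) * (r m * r a * r (a + d))) summable_on UNIV"
proof -
  obtain C where "C > 0" and C: "\<And>k. norm (r k) \<le> C"
    using norm_r_bound by blast
  define h where "h = (\<lambda>(m :: int, a :: int). C ^ 3 * (norm q ^ nat \<bar>m\<bar> * norm q ^ nat \<bar>a\<bar>))"
  have "(\<lambda>(m :: int, a :: int). norm q ^ nat \<bar>m\<bar> * norm q ^ nat \<bar>a\<bar>) summable_on UNIV \<times> UNIV"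
    by (intro summable_on_times_prod summable_norm_q_abs) auto
  then have h: "h summable_on UNIV"
    unfolding h_def by (auto intro: summable_on_cmult_right simp: case_prod_unfold)
  show ?thesis
  proof (rule abs_summable_summable, rule Infinite_Sum.abs_summable_on_comparison_test'[OF h], clarify)
    fix m a :: int
    show "norm (q powi (tri m + tri (m + 2 * a + d)) * (r m * r a * r (a + d))) \<le> h (m, a)"
    proof (cases "m < 0 \<or> a < 0 \<or> a + d < 0")
      case True
      then have "r m * r a * r (a + d) = 0"
        by auto
      then have zero: "norm (q powi (tri m + tri (m + 2 * a + d)) * (r m * r a * r (a + d))) = 0"
        by (simp only: mult_zero_right norm_zero)
      show ?thesis
        unfolding zero using \<open>C > 0\<close> by (simp add: h_def)
    next
      case False
      \<comment> \<open>On the support \<open>m\<close> and \<open>a + d\<close> are nonnegative, so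
        \<open>tri (m + 2 * a + d) \<ge> m + 2 * a + d \<ge> a\<close>.\<close>
      have "m + a \<le> tri m + tri (m + 2 * a + d)"
        using False tri_ge[of m] tri_ge[of "m + 2 * a + d"] by simp
      then have zero: "norm (q powi (tri m + tri (m + 2 * a + d))) \<le> norm q powi (m + a)"
        using norm_q q_nz False unfolding norm_power_int by (intro power_int_decreasing) auto
      also have "\<dots> = norm q ^ nat \<bar>m\<bar> * norm q ^ nat \<bar>a\<bar>"
        using False by (simp add: power_int_nonneg_exp nat_add_distrib power_add)
      finally have 1: "norm (q powi (tri m + tri (m + 2 * a + d))) \<le> norm q ^ nat \<bar>m\<bar> * norm q ^ nat \<bar>a\<bar>" .
      have 2: "norm (r m * r a * r (a + d)) \<le> C * C * C"
        unfolding norm_mult using \<open>C > 0\<close> by (intro mult_mono C) auto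
      show ?thesis
        using mult_mono[OF 1 2] unfolding h_def by (simp add: norm_mult power3_eq_cube mult_ac)
    qed
  qed
qed

text \<open>Summing over the antidiagonals \<open>m + a = s\<close> leaves the \<open>q\<close>-Vandermonde sum.\<close>

lemma pair_sum_diagonal:
  obtains F where
    "((\<lambda>(m, a). q powi (tri m + tri (m + 2 * a + d)) * (r m * r a * r (a + d))) has_sum F) UNIV"
    "((\<lambda>s. q powi (tri s + tri (s + d)) * (r s * r (s + d))) has_sum F) UNIV"
proof -
  define f where "f = (\<lambda>(m, a). q powi (tri m + tri (m + 2 * a + d)) * (r m * r a * r (a + d)))"
  obtain F where F: "(f has_sum F) UNIV"
    using summable_pair_sum unfolding f_def summable_on_def by blast
  have "((\<lambda>(s, a). f (s - a, a)) has_sum F) UNIV \<longleftrightarrow> (f has_sum F) UNIV"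
    by (rule has_sum_reindex_bij_witness[of _ "\<lambda>(m, a). (m + a, a)" "\<lambda>(s, a). (s - a, a)"]) auto
  with F have "((\<lambda>(s, a). f (s - a, a)) has_sum F) (UNIV \<times> UNIV)"
    by simp
  moreover have "((\<lambda>a. case (s, a) of (s, a) \<Rightarrow> f (s - a, a)) has_sum
      q powi (tri s + tri (s + d)) * (r s * r (s + d))) UNIV" for s
  proof -
    have "f (s - a, a) = q powi (tri s + tri (s + d)) * (q powi (a * (a + d)) * (r (s - a) * r a * r (a + d)))" for a
    proof -
      \<comment> \<open>The cross terms \<open>- s * a\<close> and \<open>(s + d) * a\<close> leave
        \<open>d * a\<close>, and \<open>2 * tri a - a = a * a\<close>; so the dependence on
        \<open>a\<close> is exactly the q-Vandermonde exponent.\<close>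
      have e: "tri (s - a) + tri (s - a + 2 * a + d) = tri s + tri (s + d) + a * (a + d)"
        using tri_diff[of s a] tri_add[of "s + d" a] two_tri[of a] by (simp add: algebra_simps)
      have "q powi (tri (s - a) + tri (s - a + 2 * a + d)) = q powi (tri s + tri (s + d)) * q powi (a * (a + d))"
        unfolding e by (rule q_powi_add)
      then show ?thesis
        unfolding f_def prod.case by simp
    qed
    then show ?thesis
      using has_sum_cmult_right[OF q_vandermonde] by simp
  qed
  ultimately have "((\<lambda>s. q powi (tri s + tri (s + d)) * (r s * r (s + d))) has_sum F) UNIV"
    by (rule has_sum_SigmaD)
  with F show ?thesis
    unfolding f_def by (rule that)
qed

text \<open>After the shift by one in the second series the exponents differ by
  \<open>tri s - tri (s - 1) = s\<close>, and \<open>q powi s * r s + r (s - 1) = r s\<close> merges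
  the two summands.\<close>

lemma durfee_shifted:
  assumes F: "((\<lambda>s. q powi (tri s + tri (s + d)) * (r s * r (s + d))) has_sum F) UNIV"
    and G: "((\<lambda>s. q powi (tri s + tri (s + (d + 1))) * (r s * r (s + (d + 1)))) has_sum G) UNIV"
  shows "((\<lambda>s. q powi tri d * (q powi (s * (s + d)) * (r s * r (s + d)))) has_sum F + G) UNIV"
proof -
  have G': "((\<lambda>s. q powi (tri (s - 1) + tri (s + d)) * (r (s - 1) * r (s + d))) has_sum G) UNIV"
    using has_sum_shift_int[THEN iffD2, OF G, of "- 1"] by simp
  have "q powi (tri s + tri (s + d)) * (r s * r (s + d)) + q powi (tri (s - 1) + tri (s + d)) * (r (s - 1) * r (s + d))
      = q powi tri d * (q powi (s * (s + d)) * (r s * r (s + d)))" for s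
  proof -
    have 1: "tri s + tri (s + d) = s + (tri d + s * (s + d))" "tri (s - 1) + tri (s + d) = tri d + s * (s + d)"
      using tri_diff[of s 1] tri_add[of s d] two_tri[of s] by (simp_all add: algebra_simps)
    show ?thesis
      unfolding r_diff_1 1 using q_nz by (simp add: power_int_add algebra_simps)
  qed
  with has_sum_add[OF F G'] show ?thesis
    by simp
qed

text \<open>The limit n -> infinity of \<open>q_vandermonde\<close>: one factor
  \<open>inverse qinf\<close> appears on the left and two on the right, and one of them
  cancels.\<close>

lemma durfee: "((\<lambda>s. q powi (s * (s + d)) * (r s * r (s + d))) has_sum inverse qinf) UNIV"
proof -
  define g where "g s = q powi (s * (s + d)) * (r s * r (s + d))" for s
  obtain F where F: "((\<lambda>s. q powi (tri s + tri (s + d)) * (r s * r (s + d))) has_sum F) UNIV"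
    by (rule pair_sum_diagonal)
  obtain G where G: "((\<lambda>s. q powi (tri s + tri (s + (d + 1))) * (r s * r (s + (d + 1)))) has_sum G) UNIV"
    by (rule pair_sum_diagonal)
  \<comment> \<open>The value is irrelevant here; what counts is that \<open>g\<close> is summable,
    hence absolutely summable, which supplies the dominating function without a new
    estimate.\<close>
  from durfee_shifted[OF F G] have "(g has_sum ((F + G) / q powi tri d)) UNIV"
    using q_nz by (simp add: has_sum_cmult_right_iff g_def[abs_def])
  then have g: "(\<lambda>s. norm (g s)) summable_on UNIV"
    by (metis has_sum_imp_summable summable_on_iff_abs_summable_on_complex)
  obtain C where "C > 0" and C: "\<And>k. norm (r k) \<le> C"
    using norm_r_bound by blast
  have "((\<lambda>s. g s * inverse qinf) has_sum inverse qinf * inverse qinf) UNIV"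
  proof (rule tannery_has_sum)
    show "((\<lambda>s. g s * r (int n - s)) has_sum r (int n + 0) * r (int n + d)) UNIV" for n
      using q_vandermonde[of d "int n"] by (simp add: g_def mult_ac)
    show "norm (g s * r (int n - s)) \<le> norm (g s) * C" for n s
      unfolding norm_mult by (intro mult_left_mono C) auto
    show "(\<lambda>s. norm (g s) * C) summable_on UNIV"
      using g by (rule summable_on_cmult_left)
    show "(\<lambda>n. g s * r (int n - s)) \<longlonglongrightarrow> g s * inverse qinf" for s
      using r_LIMSEQ[of "- s"] by (intro tendsto_mult) auto
    show "(\<lambda>n. r (int n + 0) * r (int n + d)) \<longlonglongrightarrow> inverse qinf * inverse qinf"
      by (intro tendsto_mult r_LIMSEQ)
  qed
  then show ?thesis
    by (simp add: has_sum_cmult_left_iff g_def[abs_def])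
qed

lemma pair_sum_consecutive:
  assumes F: "((\<lambda>(m, a). q powi (tri m + tri (m + 2 * a + d)) * (r m * r a * r (a + d))) has_sum F) UNIV"
    and G: "((\<lambda>(m, a). q powi (tri m + tri (m + 2 * a + (d + 1))) * (r m * r a * r (a + (d + 1)))) has_sum G) UNIV"
  shows "F + G = q powi tri d / qinf"
proof -
  have "((\<lambda>s. q powi (tri s + tri (s + d)) * (r s * r (s + d))) has_sum F) UNIV"
    by (rule pair_sum_diagonal[of d]) (use F has_sum_unique in blast)
  moreover have "((\<lambda>s. q powi (tri s + tri (s + (d + 1))) * (r s * r (s + (d + 1)))) has_sum G) UNIV"
    by (rule pair_sum_diagonal[of "d + 1"]) (use G has_sum_unique in blast)
  ultimately have "((\<lambda>s. q powi tri d * (q powi (s * (s + d)) * (r s * r (s + d)))) has_sum F + G) UNIV"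
    by (rule durfee_shifted)
  from has_sum_unique[OF this has_sum_cmult_right[OF durfee]] show ?thesis
    by (simp add: divide_inverse)
qed

section \<open>Jacobi's triple product\<close>

text \<open>The second q-Pascal rule, with upper index \<open>M + N + 1\<close>, splits each summand
  into the old one at \<open>j\<close> and \<open>- z * q ^ M\<close> times the old one at
  \<open>j - 1\<close>. The exponent \<open>tri (j - 1)\<close> is the binomial coefficient
  j(j-1)/2.\<close>

lemma finite_jacobi_triple_product_step:
  assumes "((\<lambda>j. (- 1) powi j * q powi tri (j - 1) * z powi j * (r (int N + j) * r (int M - j)))
      has_sum s) UNIV" "z \<noteq> 0"
  shows "((\<lambda>j. (- 1) powi j * q powi tri (j - 1) * z powi j * (r (int N + j) * r (int (Suc M) - j)))
      has_sum (s * (1 - z * q ^ M) / (1 - q ^ Suc (M + N)))) UNIV"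
proof -
  define c where "c j = (- 1) powi j * q powi tri (j - 1) * z powi j" for j
  define t where "t j = c j * (r (int N + j) * r (int M - j))" for j
  have t: "(t has_sum s) UNIV"
    using assms(1) by (simp add: t_def[abs_def] c_def)
  have c: "c j * q powi (int M + 1 - j) = - z * q ^ M * c (j - 1)" for j
  proof -
    have "tri (j - 1) + (int M + 1 - j) = int M + tri (j - 1 - 1)"
      using tri_diff[of "j - 1" 1] by simp
    then have "q powi tri (j - 1) * q powi (int M + 1 - j) = q ^ M * q powi tri (j - 1 - 1)"
      using q_powi_add[of "tri (j - 1)" "int M + 1 - j"] q_powi_add[of "int M" "tri (j - 1 - 1)"]
      by (simp only: power_int_of_nat)
    moreover have "z powi j = z * z powi (j - 1)" "(- 1) powi j = - ((- 1 :: complex) powi (j - 1))"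
      using \<open>z \<noteq> 0\<close> by (simp_all add: power_int_diff)
    ultimately show ?thesis
      by (simp add: c_def)
  qed
  have "(1 - q ^ Suc (M + N)) * (c j * (r (int N + j) * r (int (Suc M) - j)))
      = t j + (- z * q ^ M) * t (j - 1)" for j
  proof -
    have "int M + int N + 1 - (int N + j) = int M + 1 - j" "int M + 1 - j - 1 = int M - j"
      by simp_all
    then have "(1 - q powi (int M + int N + 1)) * (r (int N + j) * r (int M + 1 - j))
        = r (int N + j) * r (int M - j) + q powi (int M + 1 - j) * (r (int N + j - 1) * r (int M + 1 - j))"
      using r_pascal2[of "int M + int N + 1" "int N + j"] by (simp only:)
    moreover have "q powi (int M + int N + 1) = q ^ Suc (M + N)"
      using power_int_of_nat[of q "Suc (M + N)"] by (simp only: of_nat_Suc of_nat_add add_ac)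
    ultimately have "(1 - q ^ Suc (M + N)) * (r (int N + j) * r (int M + 1 - j))
        = r (int N + j) * r (int M - j) + q powi (int M + 1 - j) * (r (int N + j - 1) * r (int M + 1 - j))"
      by simp
    then have "c j * ((1 - q ^ Suc (M + N)) * (r (int N + j) * r (int M + 1 - j)))
        = t j + (c j * q powi (int M + 1 - j)) * (r (int N + j - 1) * r (int M + 1 - j))"
      by (simp only: t_def distrib_left mult.assoc)
    moreover have "int (Suc M) = int M + 1"
      by simp
    ultimately have "(1 - q ^ Suc (M + N)) * (c j * (r (int N + j) * r (int (Suc M) - j)))
        = t j + (c j * q powi (int M + 1 - j)) * (r (int N + j - 1) * r (int M + 1 - j))"
      by (simp only: mult_ac)
    also have "\<dots> = t j + (- z * q ^ M) * t (j - 1)"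
      unfolding c t_def by (simp add: algebra_simps)
    finally show ?thesis .
  qed
  moreover have "((\<lambda>j. t j + (- z * q ^ M) * t (j - 1)) has_sum s + (- z * q ^ M) * s) UNIV"
    using has_sum_shift_int[of t "- 1"] t by (intro has_sum_add has_sum_cmult_right) auto
  moreover have "s + (- z * q ^ M) * s = s * (1 - z * q ^ M)"
    by (simp add: algebra_simps)
  ultimately have "((\<lambda>j. (1 - q ^ Suc (M + N)) * (c j * (r (int N + j) * r (int (Suc M) - j))))
      has_sum s * (1 - z * q ^ M)) UNIV"
    by (simp only:)
  then show ?thesis
    by (simp add: has_sum_cmult_right_iff c_def)
qed

text \<open>The step only raises \<open>M\<close>, so it is run twice. With \<open>q / z\<close> in
  place of \<open>z\<close> it raises the upper bound from 0 to \<open>N\<close>; the reflection of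
  \<open>j\<close> turns this into the case \<open>M = 0\<close> for \<open>z\<close>, from which
  the second run starts.\<close>

lemma finite_jacobi_triple_product:
  assumes "z \<noteq> 0"
  shows "((\<lambda>j. (- 1) powi j * q powi tri (j - 1) * z powi j * (r (int N + j) * r (int M - j)))
      has_sum (q_pochhammer z q M * q_pochhammer (q / z) q N / qf (M + N))) UNIV"
proof -
  have left: "((\<lambda>j. (- 1) powi j * q powi tri (j - 1) * z powi j * (r (int N + j) * r (int M - j)))
      has_sum (p / qf N * q_pochhammer z q M / (qf (M + N) / qf N))) UNIV"
    if base: "((\<lambda>j. (- 1) powi j * q powi tri (j - 1) * z powi j * (r (int N + j) * r (int 0 - j)))
      has_sum (p / qf N)) UNIV" and "z \<noteq> 0" for z p N M
  proof (induction M)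
    case 0
    show ?case
      using base by simp
  next
    case (Suc M)
    show ?case
      using finite_jacobi_triple_product_step[OF Suc \<open>z \<noteq> 0\<close>] by (simp add: q_pochhammer_Suc mult_ac)
  qed
  have "((\<lambda>j. (- 1) powi j * q powi tri (j - 1) * (q / z) powi j * (r (int 0 + j) * r (int 0 - j)))
      has_sum (1 / qf 0)) UNIV"
  proof (rule has_sum_finite_neutralI[of "{0}"])
    fix j :: int
    assume "j \<in> UNIV - {0}"
    then have "int 0 + j < 0 \<or> int 0 - j < 0"
      by auto
    then show "(- 1) powi j * q powi tri (j - 1) * (q / z) powi j * (r (int 0 + j) * r (int 0 - j)) = 0"
      by auto
  qed auto
  from left[OF this, of N]
  have "((\<lambda>j. (- 1) powi j * q powi tri (j - 1) * (q / z) powi j * (r (int 0 + j) * r (int N - j)))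
      has_sum (q_pochhammer (q / z) q N / qf N)) UNIV"
    using assms q_nz by simp
  then have "((\<lambda>j. (- 1) powi (- j) * q powi tri (- j - 1) * (q / z) powi (- j) * (r (- j) * r (int N + j)))
      has_sum (q_pochhammer (q / z) q N / qf N)) UNIV"
    using has_sum_reflect_int[of "\<lambda>j. (- 1) powi j * q powi tri (j - 1) * (q / z) powi j * (r j * r (int N - j))" 0]
    by simp
  moreover have "(- 1) powi (- j) * q powi tri (- j - 1) * (q / z) powi (- j)
      = (- 1) powi j * q powi tri (j - 1) * z powi j" for j
  proof -
    \<comment> \<open>The surplus \<open>j\<close> is cancelled by the factor
      \<open>q powi (- j)\<close> in \<open>(q / z) powi (- j)\<close>.\<close>
    have "tri (- j - 1) = tri (j - 1) + j"
      using tri_minus[of "j + 1"] tri_add[of j 1] tri_diff[of j 1] by simp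
    then show ?thesis
      using q_nz assms by (simp add: power_int_add power_int_minus power_int_divide_distrib field_simps)
  qed
  ultimately have "((\<lambda>j. (- 1) powi j * q powi tri (j - 1) * z powi j * (r (- j) * r (int N + j)))
      has_sum (q_pochhammer (q / z) q N / qf N)) UNIV"
    by (simp only:)
  then have "((\<lambda>j. (- 1) powi j * q powi tri (j - 1) * z powi j * (r (int N + j) * r (int 0 - j)))
      has_sum (q_pochhammer (q / z) q N / qf N)) UNIV"
    by (simp add: mult_ac)
  from left[OF this assms, of M] show ?thesis
    by (simp add: mult_ac)
qed

text \<open>The case \<open>M = N = n\<close> of the finite form, as n -> infinity. The two
  \<open>r\<close> factors on the left each tend to \<open>inverse qinf\<close>, while
  \<open>r (2 * n)\<close> on the right contributes only one, which leaves the factor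
  \<open>qinf\<close>.\<close>

theorem jacobi_triple_product:
  assumes "z \<noteq> 0" and summable: "(\<lambda>j. (- 1) powi j * q powi tri (j - 1) * z powi j) summable_on UNIV"
  shows "((\<lambda>j. (- 1) powi j * q powi tri (j - 1) * z powi j)
      has_sum (qinf * q_pochhammer_inf z q * q_pochhammer_inf (q / z) q)) UNIV"
proof -
  define c where "c j = (- 1) powi j * q powi tri (j - 1) * z powi j" for j
  obtain C where "C > 0" and C: "\<And>k. norm (r k) \<le> C"
    using norm_r_bound by blast
  have "((\<lambda>j. c j * (inverse qinf * inverse qinf))
      has_sum (qinf * q_pochhammer_inf z q * q_pochhammer_inf (q / z) q * (inverse qinf * inverse qinf))) UNIV"
  proof (rule tannery_has_sum)
    show "((\<lambda>j. c j * (r (int n + j) * r (int n - j)))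
        has_sum (q_pochhammer z q n * q_pochhammer (q / z) q n * r (int (2 * n) + 0))) UNIV" for n
      using finite_jacobi_triple_product[OF assms(1), of n n] unfolding c_def r_of_nat add_0_right
      by (simp add: divide_inverse mult_2)
    show "norm (c j * (r (int n + j) * r (int n - j))) \<le> norm (c j) * (C * C)" for n j
      unfolding norm_mult using \<open>C > 0\<close> by (intro mult_left_mono mult_mono C) auto
    show "(\<lambda>j. norm (c j) * (C * C)) summable_on UNIV"
      using summable by (intro summable_on_cmult_left) (simp add: c_def summable_on_iff_abs_summable_on_complex)
    show "(\<lambda>n. c j * (r (int n + j) * r (int n - j))) \<longlonglongrightarrow> c j * (inverse qinf * inverse qinf)" for j
      using r_LIMSEQ[of "- j"] by (intro tendsto_mult r_LIMSEQ) auto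
    have "(\<lambda>n. r (int (2 * n) + 0)) \<longlonglongrightarrow> inverse qinf"
      using LIMSEQ_subseq_LIMSEQ[OF r_LIMSEQ[of 0], of "\<lambda>n. 2 * n"] by (simp add: o_def strict_mono_def del: of_nat_mult)
    then have "(\<lambda>n. q_pochhammer z q n * q_pochhammer (q / z) q n * r (int (2 * n) + 0))
        \<longlonglongrightarrow> q_pochhammer_inf z q * q_pochhammer_inf (q / z) q * inverse qinf"
      by (intro tendsto_mult q_pochhammer_LIMSEQ norm_q)
    then show "(\<lambda>n. q_pochhammer z q n * q_pochhammer (q / z) q n * r (int (2 * n) + 0))
        \<longlonglongrightarrow> qinf * q_pochhammer_inf z q * q_pochhammer_inf (q / z) q * (inverse qinf * inverse qinf)"
      by (simp add: field_simps)
  qed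
  then have "(c has_sum (qinf * q_pochhammer_inf z q * q_pochhammer_inf (q / z) q)) UNIV"
    by (simp add: has_sum_cmult_left_iff)
  then show ?thesis
    unfolding c_def .
qed

section \<open>Bressoud's finite Rogers--Ramanujan identity\<close>

lemma minus_one_powi_minus: "(- 1) powi (- j) = (- 1 :: complex) powi j"
  by (simp add: power_int_minus flip: power_int_inverse)

lemma minus_one_powi_reflect: "(- 1) powi (- 1 - j) = - ((- 1 :: complex) powi j)"
proof -
  have "- 1 - j = - (j + 1)"
    by simp
  then show ?thesis
    by (simp only: minus_one_powi_minus) (simp add: power_int_add)
qed

text \<open>
  Bressoud's identity is the case \<open>e = 0\<close> of \<open>S_term\<close> against \<open>e = 2\<close> of \<open>P_term\<close>. It is proved
  together with its companion, \<open>e = 1\<close> of \<open>S_term\<close> against \<open>i = 1\<close>, \<open>e = 1\<close> of \<open>P_term\<close>, because only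
  the pair satisfies a closed first-order recurrence in \<open>N\<close>.
\<close>

definition S_term :: "int \<Rightarrow> int \<Rightarrow> int \<Rightarrow> complex" where
  "S_term e N n = q powi (n * n + e * n) * (r n * r (N - n))"

text \<open>Here \<open>i\<close> is the parity of k = 2N + i, so the indices of the two
  \<open>r\<close> factors add up to k.\<close>

definition P_term :: "int \<Rightarrow> int \<Rightarrow> int \<Rightarrow> int \<Rightarrow> complex" where
  "P_term i e N j = (- 1) powi j * q powi (5 * tri j - e * j) * (r (N - 2 * j) * r (N + i + 2 * j))"

text \<open>In the second q-Pascal piece, n^2 + (M - n) = M + (n-1)^2 + (n-1), which is the
  companion's exponent at \<open>n - 1\<close>.\<close>

lemma S_term_0_step:
  "(1 - q powi M) * S_term 0 M n = S_term 0 (M - 1) n + q powi M * S_term 1 (M - 1) (n - 1)"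
proof -
  have e: "n * n + (M - n) = M + ((n - 1) * (n - 1) + 1 * (n - 1))"
    by (simp add: algebra_simps)
  have e': "M - 1 - n = M - n - 1" "M - 1 - (n - 1) = M - n"
    by simp_all
  have "(1 - q powi M) * S_term 0 M n = q powi (n * n) * ((1 - q powi M) * (r n * r (M - n)))"
    by (simp add: S_term_def)
  also have "\<dots> = q powi (n * n) * (r n * r (M - n - 1)) + q powi (n * n + (M - n)) * (r (n - 1) * r (M - n))"
    unfolding r_pascal2 q_powi_add by (simp add: algebra_simps)
  also have "\<dots> = S_term 0 (M - 1) n + q powi M * S_term 1 (M - 1) (n - 1)"
    unfolding e q_powi_add S_term_def e' by simp
  finally show ?thesis .
qed

lemma S_term_1_step: "S_term 1 M n = S_term 1 (M - 1) n + q powi M * S_term 0 M n"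
proof -
  have e: "M - 1 - n = (M - n) - 1"
    by simp
  have "q powi (n * n + 1 * n) * q powi (M - n) = q powi M * q powi (n * n + 0 * n)"
    unfolding q_powi_add[symmetric] by (simp add: algebra_simps)
  then show ?thesis
    unfolding S_term_def e r_diff_1 by (simp add: algebra_simps)
qed

text \<open>One q-Pascal step lowers the index total from 2M to 2M - 1. The piece that gains q^(M -
  2j) is the companion at \<open>- j\<close>, since 5 tri(j) - 4j = 5 tri(-j) + j.\<close>

lemma P_term_0_2_step:
  "(1 - q powi (2 * M)) * P_term 0 2 M j = q powi M * P_term 1 1 (M - 1) (- j) + P_term 1 2 (M - 1) j"
proof -
  define c :: complex where "c = (- 1) powi j"
  have c: "(- 1) powi (- j) = c"
    by (simp add: c_def minus_one_powi_minus)
  have e: "2 * M - (M - 2 * j) = M + 2 * j" "5 * tri j - 2 * j + (M - 2 * j) = M + (5 * tri (- j) - 1 * - j)"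
    "M - 1 - 2 * - j = M + 2 * j - 1" "M - 1 + 1 + 2 * - j = M - 2 * j" "M - 1 - 2 * j = M - 2 * j - 1"
    "M - 1 + 1 + 2 * j = M + 2 * j" "M + 0 + 2 * j = M + 2 * j"
    by (simp_all add: tri_minus)
  have "(1 - q powi (2 * M)) * P_term 0 2 M j = c * q powi (5 * tri j - 2 * j) *
      ((1 - q powi (2 * M)) * (r (M - 2 * j) * r (M + 2 * j)))"
    by (simp add: P_term_def c_def)
  also have "\<dots> = c * q powi (5 * tri j - 2 * j + (M - 2 * j)) * (r (M - 2 * j) * r (M + 2 * j - 1))
      + c * q powi (5 * tri j - 2 * j) * (r (M - 2 * j - 1) * r (M + 2 * j))"
    unfolding r_pascal1[of "2 * M" "M - 2 * j", unfolded e(1)] q_powi_add by (simp add: algebra_simps)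
  also have "\<dots> = q powi M * P_term 1 1 (M - 1) (- j) + P_term 1 2 (M - 1) j"
    unfolding P_term_def e(2-) q_powi_add c by (simp add: c_def mult_ac)
  finally show ?thesis .
qed

text \<open>The halfway stage of the companion's recurrence: going from \<open>M\<close> to
  \<open>M - 1\<close> lowers the index total 2M + 1 by two, so two q-Pascal steps are required, and
  this is the remainder of the first, with total 2M.\<close>

definition E_term :: "int \<Rightarrow> int \<Rightarrow> complex" where
  "E_term M j = (- 1) powi j * q powi (5 * tri j - j) * (r (M - 2 * j - 1) * r (M + 1 + 2 * j))"

lemma P_term_1_1_step:
  shows "(1 - q powi (2 * M + 1)) * P_term 1 1 M j = q powi M * P_term 0 2 M (- j) + E_term M j"
    and "(1 - q powi (2 * M)) * E_term M j = P_term 1 1 (M - 1) j - q powi M * P_term 1 1 (M - 1) (- 1 - j)"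
proof -
  define c :: complex where "c = (- 1) powi j"
  have c: "(- 1) powi (- j) = c" "(- 1) powi (- 1 - j) = - c"
    by (simp_all add: c_def minus_one_powi_minus minus_one_powi_reflect)
  have e: "2 * M + 1 - (M - 2 * j) = M + 1 + 2 * j" "5 * tri j - 1 * j + (M - 2 * j) = M + (5 * tri (- j) - 2 * - j)"
    "M + 1 + 2 * j - 1 = M + 2 * j" "M - 2 * - j = M + 2 * j" "M + 0 + 2 * - j = M - 2 * j"
    by (simp_all add: tri_minus)
  have "(1 - q powi (2 * M + 1)) * P_term 1 1 M j = c * q powi (5 * tri j - 1 * j) *
      ((1 - q powi (2 * M + 1)) * (r (M - 2 * j) * r (M + 1 + 2 * j)))"
    by (simp add: P_term_def c_def)
  also have "\<dots> = c * q powi (5 * tri j - 1 * j + (M - 2 * j)) * (r (M - 2 * j) * r (M + 2 * j))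
      + c * q powi (5 * tri j - 1 * j) * (r (M - 2 * j - 1) * r (M + 1 + 2 * j))"
    unfolding r_pascal1[of "2 * M + 1" "M - 2 * j", unfolded e(1,3)] q_powi_add[of _ "M - 2 * j"]
    by (simp add: algebra_simps)
  also have "\<dots> = q powi M * P_term 0 2 M (- j) + E_term M j"
    unfolding P_term_def e(2-) q_powi_add c E_term_def by (simp add: c_def mult_ac)
  finally show "(1 - q powi (2 * M + 1)) * P_term 1 1 M j = q powi M * P_term 0 2 M (- j) + E_term M j" .
  have f: "2 * M - (M - 2 * j - 1) = M + 1 + 2 * j"
    "5 * tri j - 1 * j + (M + 1 + 2 * j) = M + (5 * tri (- 1 - j) - 1 * (- 1 - j))"
    "M + 1 + 2 * j - 1 = M + 2 * j" "M - 1 - 2 * (- 1 - j) = M + 1 + 2 * j"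
    "M - 1 + 1 + 2 * (- 1 - j) = M - 2 * j - 1 - 1" "M - 1 - 2 * j = M - 2 * j - 1" "M - 1 + 1 + 2 * j = M + 2 * j"
    by (simp_all add: tri_diff)
  have "(1 - q powi (2 * M)) * E_term M j = c * q powi (5 * tri j - 1 * j) *
      ((1 - q powi (2 * M)) * (r (M - 2 * j - 1) * r (M + 1 + 2 * j)))"
    by (simp add: E_term_def c_def)
  also have "\<dots> = c * q powi (5 * tri j - 1 * j) * (r (M - 2 * j - 1) * r (M + 2 * j))
      + c * q powi (5 * tri j - 1 * j + (M + 1 + 2 * j)) * (r (M - 2 * j - 1 - 1) * r (M + 1 + 2 * j))"
    unfolding r_pascal2[of "2 * M" "M - 2 * j - 1", unfolded f(1,3)] q_powi_add[of _ "M + 1 + 2 * j"]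
    by (simp add: algebra_simps)
  also have "\<dots> = P_term 1 1 (M - 1) j - q powi M * P_term 1 1 (M - 1) (- 1 - j)"
    unfolding P_term_def f(2,4-) q_powi_add[of M] c by (simp add: c_def mult_ac)
  finally show "(1 - q powi (2 * M)) * E_term M j = P_term 1 1 (M - 1) j - q powi M * P_term 1 1 (M - 1) (- 1 - j)" .
qed

text \<open>The difference of the two sums is antisymmetric under \<open>j \<mapsto> - 1 - j\<close>.\<close>

lemma P_term_1_2_has_sum:
  assumes "(P_term 0 2 M has_sum x) UNIV"
  shows "((\<lambda>j. (1 - q powi (2 * M + 1)) * P_term 1 2 M j) has_sum x) UNIV"
proof -
  \<comment> \<open>The q-Pascal remainder. Its linear exponent \<open>- 2 * j\<close> is cancelled
    by the gained \<open>M + 1 + 2 * j\<close>, so only \<open>tri j\<close> remains, which the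
    reflection preserves while swapping the \<open>r\<close> factors and flipping the sign.\<close>
  define X where "X j = (- 1) powi j * q powi (5 * tri j + (M + 1)) * (r (M - 2 * j - 1) * r (M + 1 + 2 * j))" for j
  have "(1 - q powi (2 * M + 1)) * P_term 1 2 M j = P_term 0 2 M j + X j" for j
  proof -
    have e: "2 * M + 1 - (M - 2 * j) = M + 1 + 2 * j" "M + 1 + 2 * j - 1 = M + 0 + 2 * j"
      "5 * tri j - 2 * j + (M + 1 + 2 * j) = 5 * tri j + (M + 1)"
      by simp_all
    have "(1 - q powi (2 * M + 1)) * P_term 1 2 M j = (- 1) powi j * q powi (5 * tri j - 2 * j) *
        ((1 - q powi (2 * M + 1)) * (r (M - 2 * j) * r (M + 1 + 2 * j)))"
      by (simp add: P_term_def)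
    also have "\<dots> = (- 1) powi j * q powi (5 * tri j - 2 * j) * (r (M - 2 * j) * r (M + 0 + 2 * j))
        + (- 1) powi j * q powi (5 * tri j - 2 * j + (M + 1 + 2 * j)) * (r (M - 2 * j - 1) * r (M + 1 + 2 * j))"
      unfolding r_pascal2[of "2 * M + 1" "M - 2 * j", unfolded e(1,2)] q_powi_add[of _ "M + 1 + 2 * j"]
      by (simp add: algebra_simps)
    also have "\<dots> = P_term 0 2 M j + X j"
      unfolding P_term_def X_def e by simp
    finally show ?thesis .
  qed
  moreover have "(X has_sum 0) UNIV"
  proof -
    have "X summable_on UNIV"
    proof (rule summable_on_int_supportI)
      fix j
      assume "X j \<noteq> 0"
      then have "\<not> M - 2 * j - 1 < 0" "\<not> M + 1 + 2 * j < 0"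
        by (auto simp: X_def)
      then show "- \<bar>M\<bar> - 1 \<le> j \<and> j \<le> \<bar>M\<bar>"
        by auto
    qed
    then obtain s where s: "(X has_sum s) UNIV"
      by (auto simp: summable_on_def)
    have "X (- 1 - j) = - X j" for j
    proof -
      have e: "M - 2 * (- 1 - j) - 1 = M + 1 + 2 * j" "M + 1 + 2 * (- 1 - j) = M - 2 * j - 1" "tri (- 1 - j) = tri j"
        by (simp_all add: tri_diff)
      show ?thesis
        unfolding X_def e minus_one_powi_reflect by simp
    qed
    with has_sum_reflect_int[of X "- 1"] s have "((\<lambda>j. - X j) has_sum s) UNIV"
      by simp
    moreover have "((\<lambda>j. - X j) has_sum - s) UNIV"
      using s by (simp add: has_sum_uminus)
    ultimately have "s = - s"
      by (rule has_sum_unique)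
    with s show ?thesis
      by simp
  qed
  ultimately show ?thesis
    using has_sum_add[OF assms] by fastforce
qed

text \<open>Both sides have the same numerators \<open>b\<close> and \<open>c\<close> over different
  q-factorials, because these start at 1 and obey the same recurrence. The \<open>P_term 1 2\<close>
  clause is the odd case of the result and also feeds the next step of
  \<open>P_term 0 2\<close>.\<close>

lemma bressoud_recurrence:
  "\<exists>b c. (S_term 0 N has_sum b / qf N) UNIV \<and> (S_term 1 N has_sum c / qf N) UNIV
    \<and> (P_term 0 2 N has_sum b / qf (2 * N)) UNIV \<and> (P_term 1 2 N has_sum b / qf (2 * N + 1)) UNIV
    \<and> (P_term 1 1 N has_sum c / qf (2 * N + 1)) UNIV"
proof (induction N)
  case 0
  have S: "(S_term e (int 0) has_sum 1 / qf 0) UNIV" for e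
  proof (rule has_sum_finite_neutralI[of "{0}"])
    show "S_term e (int 0) n = 0" if "n \<in> UNIV - {0}" for n
      using that by (cases "n < 0") (auto simp: S_term_def)
  qed (auto simp: S_term_def)
  have P: "(P_term i e (int 0) has_sum r i) UNIV" if "i = 0 \<or> i = 1" for i e
  proof (rule has_sum_finite_neutralI[of "{0}"])
    show "P_term i e (int 0) n = 0" if "n \<in> UNIV - {0}" for n
      using that \<open>i = 0 \<or> i = 1\<close> by (cases "n < 0") (auto simp: P_term_def)
  qed (auto simp: P_term_def)
  have "r 1 = 1 / qf 1"
    using r_of_nat[of 1] by (simp add: divide_inverse)
  then show ?case
    using S[of 0] S[of 1] P[of 0 2] P[of 1 2] P[of 1 1] by (intro exI[of _ 1]) simp
next
  case (Suc N)
  then obtain b c where S0: "(S_term 0 N has_sum b / qf N) UNIV" and S1: "(S_term 1 N has_sum c / qf N) UNIV"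
    and P12: "(P_term 1 2 N has_sum b / qf (2 * N + 1)) UNIV"
    and P11: "(P_term 1 1 N has_sum c / qf (2 * N + 1)) UNIV"
    by blast
  define M where "M = int (Suc N)"
  have M: "M - 1 = int N" "int (Suc N) = M"
    by (simp_all add: M_def)
  \<comment> \<open>Read off from \<open>S_term_0_step\<close> and \<open>S_term_1_step\<close>
    after clearing denominators; the product side must reproduce exactly these values.\<close>
  define b' where "b' = b + q powi M * c"
  define c' where "c' = (1 - q powi M) * c + q powi M * b'"
  have nz: "1 - q powi M \<noteq> 0" "1 - q powi (2 * M) \<noteq> 0" "1 - q powi (2 * M + 1) \<noteq> 0"
    by (rule one_minus_q_powi_nz; simp add: M_def)+
  have qfM: "qf (Suc N) = qf N * (1 - q powi M)"
    "qf (2 * Suc N) = qf (2 * N + 1) * (1 - q powi (2 * M))"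
    "qf (2 * Suc N + 1) = qf (2 * Suc N) * (1 - q powi (2 * M + 1))"
  proof -
    have "2 * M = int (Suc (2 * N + 1))" "2 * M + 1 = int (Suc (2 * Suc N))"
      by (simp_all add: M_def)
    then have "q powi (2 * M) = q * q ^ (2 * N + 1)" "q powi (2 * M + 1) = q * q ^ (2 * Suc N)"
      by (simp_all only: power_int_of_nat power_Suc)
    moreover have "q powi M = q * q ^ N"
      unfolding M_def power_int_of_nat by simp
    moreover have "qf (2 * Suc N) = qf (Suc (2 * N + 1))" "qf (2 * Suc N + 1) = qf (Suc (2 * Suc N))"
      by simp_all
    ultimately show "qf (Suc N) = qf N * (1 - q powi M)"
      "qf (2 * Suc N) = qf (2 * N + 1) * (1 - q powi (2 * M))"
      "qf (2 * Suc N + 1) = qf (2 * Suc N) * (1 - q powi (2 * M + 1))"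
      by (simp_all only: q_pochhammer_Suc)
  qed
  have S0': "(S_term 0 M has_sum b' / qf (Suc N)) UNIV"
  proof -
    have "((\<lambda>n. S_term 1 N (n - 1)) has_sum c / qf N) UNIV"
      using has_sum_shift_int[of "S_term 1 N" "- 1"] S1 by simp
    from has_sum_add[OF S0 has_sum_cmult_right[OF this]]
    have "((\<lambda>n. (1 - q powi M) * S_term 0 M n) has_sum (b / qf N + q powi M * (c / qf N))) UNIV"
      unfolding S_term_0_step M .
    moreover have "(b / qf N + q powi M * (c / qf N)) / (1 - q powi M) = b' / qf (Suc N)"
      unfolding qfM b'_def by (simp add: add_divide_distrib)
    ultimately show ?thesis
      using nz by (simp only: has_sum_cmult_right_iff not_False_eq_True)
  qed
  have S1': "(S_term 1 M has_sum c' / qf (Suc N)) UNIV"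
  proof -
    have "(S_term 1 M has_sum c / qf N + q powi M * (b' / qf (Suc N))) UNIV"
      unfolding S_term_1_step[of M, abs_def] M using S1 S0' by (intro has_sum_add has_sum_cmult_right)
    moreover have "c / qf N + q powi M * (b' / qf (Suc N)) = c' / qf (Suc N)"
      using nz unfolding qfM c'_def by (simp add: field_simps)
    ultimately show ?thesis
      by simp
  qed
  have P02': "(P_term 0 2 M has_sum b' / qf (2 * Suc N)) UNIV"
  proof -
    have "((\<lambda>j. P_term 1 1 N (- j)) has_sum c / qf (2 * N + 1)) UNIV"
      using has_sum_reflect_int[of "P_term 1 1 N" 0] P11 by simp
    from has_sum_add[OF has_sum_cmult_right[OF this] P12]
    have "((\<lambda>j. (1 - q powi (2 * M)) * P_term 0 2 M j) has_sum
        (q powi M * (c / qf (2 * N + 1)) + b / qf (2 * N + 1))) UNIV"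
      unfolding P_term_0_2_step M .
    moreover have "(q powi M * (c / qf (2 * N + 1)) + b / qf (2 * N + 1)) / (1 - q powi (2 * M)) = b' / qf (2 * Suc N)"
      unfolding qfM b'_def by (simp add: add_divide_distrib add.commute)
    ultimately show ?thesis
      using nz by (simp only: has_sum_cmult_right_iff not_False_eq_True)
  qed
  have P12': "(P_term 1 2 M has_sum b' / qf (2 * Suc N + 1)) UNIV"
    using P_term_1_2_has_sum[OF P02'] nz(3) unfolding qfM(3)
    by (simp only: has_sum_cmult_right_iff not_False_eq_True divide_divide_eq_left)
  have P11': "(P_term 1 1 M has_sum c' / qf (2 * Suc N + 1)) UNIV"
  proof -
    have "((\<lambda>j. P_term 1 1 N (- 1 - j)) has_sum c / qf (2 * N + 1)) UNIV"
      using has_sum_reflect_int[of "P_term 1 1 N" "- 1"] P11 by simp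
    from has_sum_add[OF P11 has_sum_cmult_right[OF this, of "- (q powi M)"]]
    have "((\<lambda>j. (1 - q powi (2 * M)) * E_term M j) has_sum (c / qf (2 * N + 1) - q powi M * (c / qf (2 * N + 1)))) UNIV"
      unfolding P_term_1_1_step(2) M by simp
    moreover have "(c / qf (2 * N + 1) - q powi M * (c / qf (2 * N + 1))) / (1 - q powi (2 * M))
        = (1 - q powi M) * c / qf (2 * Suc N)"
      unfolding qfM(2) by (simp add: diff_divide_distrib left_diff_distrib)
    ultimately have "(E_term M has_sum (1 - q powi M) * c / qf (2 * Suc N)) UNIV"
      using nz by (simp only: has_sum_cmult_right_iff not_False_eq_True)
    moreover have "((\<lambda>j. P_term 0 2 M (- j)) has_sum b' / qf (2 * Suc N)) UNIV"
      using has_sum_reflect_int[of "P_term 0 2 M" 0] P02' by simp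
    ultimately have "((\<lambda>j. (1 - q powi (2 * M + 1)) * P_term 1 1 M j) has_sum
        (q powi M * (b' / qf (2 * Suc N)) + (1 - q powi M) * c / qf (2 * Suc N))) UNIV"
      unfolding P_term_1_1_step(1) by (intro has_sum_add has_sum_cmult_right)
    moreover have "(q powi M * (b' / qf (2 * Suc N)) + (1 - q powi M) * c / qf (2 * Suc N)) / (1 - q powi (2 * M + 1))
        = c' / qf (2 * Suc N + 1)"
      unfolding qfM(3) c'_def by (simp add: add_divide_distrib add.commute)
    ultimately show ?thesis
      using nz by (simp only: has_sum_cmult_right_iff not_False_eq_True)
  qed
  show ?case
    unfolding M(2) using S0' S1' P02' P12' P11' by blast
qed

text \<open>Both parities of \<open>k\<close> in one form. The factor \<open>qf k\<close> is kept
  outside \<beta> so that it cancels the 1/(q)_k of the triple sum.\<close>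

lemma bressoud:
  obtains \<beta> where
    "((\<lambda>n. q ^ n\<^sup>2 * q_binomial q (k div 2) n) has_sum qf k * \<beta>) UNIV"
    "((\<lambda>j. (- 1) powi j * q powi (5 * tri j - 2 * j) *
        (r (int (k div 2) - 2 * j) * r (int (k - k div 2) + 2 * j))) has_sum \<beta>) UNIV"
proof -
  define N where "N = k div 2"
  define i where "i = k mod 2"
  have k: "k = 2 * N + i" and i: "i = 0 \<or> i = 1"
    by (auto simp: N_def i_def)
  obtain b where S: "(S_term 0 N has_sum b / qf N) UNIV" and P: "(P_term (int i) 2 N has_sum b / qf k) UNIV"
    using bressoud_recurrence[of N] i k by auto
  have "int (k - k div 2) = int N + int i"
    using i by (auto simp: k)
  then have "((\<lambda>j. (- 1) powi j * q powi (5 * tri j - 2 * j) *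
        (r (int (k div 2) - 2 * j) * r (int (k - k div 2) + 2 * j))) has_sum b / qf k) UNIV"
    using P by (simp only: P_term_def[abs_def] N_def)
  moreover have "((\<lambda>n. q ^ n\<^sup>2 * q_binomial q (k div 2) n) has_sum qf k * (b / qf k)) UNIV"
  proof -
    have "((\<lambda>n. qf N * S_term 0 N n) has_sum b) UNIV"
      using has_sum_cmult_right[OF S, of "qf N"] by simp
    also have "?this \<longleftrightarrow> ((\<lambda>n. qf N * S_term 0 N n) has_sum b) {0..}"
      by (rule has_sum_cong_neutral) (auto simp: S_term_def)
    also have "\<dots> \<longleftrightarrow> ((\<lambda>n. qf N * S_term 0 N (int n)) has_sum b) UNIV"
      by (rule has_sum_reindex_bij_witness[of _ int nat]) auto
    finally have "((\<lambda>n. qf N * S_term 0 N (int n)) has_sum b) UNIV" .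
    moreover have "qf N * S_term 0 N (int n) = q ^ n\<^sup>2 * q_binomial q (k div 2) n" for n
    proof -
      have "q powi (int n * int n + 0 * int n) = q ^ n\<^sup>2"
        using power_int_of_nat[of q "n\<^sup>2"] by (simp add: power2_eq_square)
      moreover have "r (int N - int n) = (if n \<le> N then inverse (qf (N - n)) else 0)"
        using r_of_nat[of "N - n"] by (auto simp: of_nat_diff simp del: r_of_nat)
      ultimately show ?thesis
        unfolding S_term_def q_binomial_def N_def[symmetric] by (simp add: divide_inverse)
    qed
    ultimately show ?thesis
      by simp
  qed
  ultimately show ?thesis
    by (rule that[rotated])
qed

section \<open>The triple sum\<close>

lemma summable_norm_q: "(\<lambda>n. norm q ^ n) summable_on (UNIV :: nat set)"
  using norm_q by (simp add: summable_on_UNIV_nonneg_real_iff)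

lemma pair_sum_parity:
  assumes i: "i = 0 \<or> i = 1"
    and F: "((\<lambda>(m, a). q powi (tri m + tri (m + 2 * a + (4 * j + int i))) * (r m * r a * r (a + (4 * j + int i)))) has_sum F) UNIV"
  shows "((\<lambda>(m, k). q ^ (T m + T (m + k)) * (r (int m) * r (int (k div 2) - 2 * j) * r (int (k - k div 2) + 2 * j)))
    has_sum F) {(m, k). k mod 2 = i}"
proof -
  define f where "f = (\<lambda>(m, a). q powi (tri m + tri (m + 2 * a + (4 * j + int i))) * (r m * r a * r (a + (4 * j + int i))))"
  have "(f has_sum F) UNIV \<longleftrightarrow> (f has_sum F) {(m, a). 0 \<le> m \<and> 0 \<le> a + 2 * j}"
  proof (rule has_sum_cong_neutral)
    fix x :: "int \<times> int"
    assume "x \<in> UNIV - {(m, a). 0 \<le> m \<and> 0 \<le> a + 2 * j}"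
    moreover obtain m a where x: "x = (m, a)"
      by fastforce
    \<comment> \<open>If \<open>a + 2 * j < 0\<close>, the two numbers \<open>a\<close> and
      \<open>a + (4 * j + i)\<close> add up to \<open>2 * (a + 2 * j) + i \<le> - 1\<close>, so one
      of them is negative.\<close>
    ultimately have "m < 0 \<or> a < 0 \<or> a + (4 * j + int i) < 0"
      using i by auto
    then have "r m * r a * r (a + (4 * j + int i)) = 0"
      by auto
    then show "f x = 0"
      by (simp only: f_def x prod.case mult_zero_right)
  qed auto
  also have "\<dots> \<longleftrightarrow> ((\<lambda>(m, k). q ^ (T m + T (m + k)) * (r (int m) * r (int (k div 2) - 2 * j) * r (int (k - k div 2) + 2 * j)))
      has_sum F) {(m, k). k mod 2 = i}"
  proof (rule has_sum_reindex_bij_witness[of _ "\<lambda>(m, k). (int m, int (k div 2) - 2 * j)"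
        "\<lambda>(m, a). (nat m, 2 * nat (a + 2 * j) + i)"], goal_cases)
    case (5 x)
    then obtain m N where x: "x = (int m, int N - 2 * j)"
      by (cases x) (auto, metis add_diff_cancel_right' nat_0_le)
    have N: "(2 * N + i) div 2 = N" "2 * N + i - N = N + i" "int N - 2 * j + 2 * j = int N"
      using i by auto
    have e: "int m + 2 * (int N - 2 * j) + (4 * j + int i) = int (m + (2 * N + i))"
      "int N - 2 * j + (4 * j + int i) = int (N + i) + 2 * j"
      by simp_all
    show ?case
      unfolding x f_def prod.case nat_int N e tri_of_nat of_nat_add[symmetric] power_int_of_nat ..
  qed (use i in auto, presburger)
  finally show ?thesis
    using F unfolding f_def by simp
qed

lemma fixed_index_sum:
  "((\<lambda>(m, k). q ^ (T m + T (m + k)) * (r (int m) * r (int (k div 2) - 2 * j) * r (int (k - k div 2) + 2 * j)))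
    has_sum q powi tri (4 * j) / qinf) UNIV"
proof -
  obtain F where F: "((\<lambda>(m, a). q powi (tri m + tri (m + 2 * a + 4 * j)) * (r m * r a * r (a + 4 * j))) has_sum F) UNIV"
    by (rule pair_sum_diagonal)
  obtain G where G: "((\<lambda>(m, a). q powi (tri m + tri (m + 2 * a + (4 * j + 1))) * (r m * r a * r (a + (4 * j + 1)))) has_sum G) UNIV"
    by (rule pair_sum_diagonal)
  have "{(m, k). k mod 2 = 0} \<union> {(m, k). k mod 2 = 1} = (UNIV :: (nat \<times> nat) set)"
    by auto
  moreover have "((\<lambda>(m, k). q ^ (T m + T (m + k)) * (r (int m) * r (int (k div 2) - 2 * j) * r (int (k - k div 2) + 2 * j)))
      has_sum F + G) ({(m, k). k mod 2 = 0} \<union> {(m, k). k mod 2 = 1})"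
    using F G by (intro has_sum_Un_disjoint pair_sum_parity) auto
  ultimately show ?thesis
    using pair_sum_consecutive[OF F G] by simp
qed

section \<open>Absolute summability of the multiple sums\<close>

lemma summable_index_sum:
  "(\<lambda>(j, (m, k)). (- 1) powi j * q powi (5 * tri j - 2 * j) *
      (q ^ (T m + T (m + k)) * (r (int m) * r (int (k div 2) - 2 * j) * r (int (k - k div 2) + 2 * j))))
    summable_on UNIV"
proof -
  obtain C where "C > 0" and C: "\<And>k. norm (r k) \<le> C"
    using norm_r_bound by blast
  define h where "h = (\<lambda>(j :: int, (m, k)). C ^ 3 * (norm q ^ nat \<bar>j\<bar> * (norm q ^ m * norm q ^ k)))"
  have "(\<lambda>(m, k). norm q ^ m * norm q ^ k) summable_on UNIV \<times> UNIV"
    by (intro summable_on_times_prod summable_norm_q) auto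
  then have "(\<lambda>(j :: int, x). norm q ^ nat \<bar>j\<bar> * (case x of (m, k) \<Rightarrow> norm q ^ m * norm q ^ k)) summable_on UNIV \<times> UNIV"
    by (intro summable_on_times_prod summable_norm_q_abs) auto
  then have h: "h summable_on UNIV"
    unfolding h_def by (auto intro: summable_on_cmult_right simp: case_prod_unfold)
  show ?thesis
  proof (rule abs_summable_summable, rule Infinite_Sum.abs_summable_on_comparison_test'[OF h], clarify)
    fix j :: int and m k :: nat
    \<comment> \<open>The \<open>r\<close> factors are merely bounded, so decay in \<open>j\<close>
      has to come from this exponent.\<close>
    have "\<bar>j\<bar> \<le> 5 * tri j - 2 * j"
      using tri_ge[of j] tri_nonneg[of j] by linarith
    then have "norm q powi (5 * tri j - 2 * j) \<le> norm q powi \<bar>j\<bar>"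
      using norm_q q_nz by (intro power_int_decreasing) auto
    then have 1: "norm ((- 1) powi j * q powi (5 * tri j - 2 * j)) \<le> norm q ^ nat \<bar>j\<bar>"
      by (simp add: norm_mult norm_power_int power_int_nonneg_exp)
    have "m + k \<le> T m + T (m + k)"
      using T_ge[of m] T_ge[of "m + k"] by linarith
    then have 2: "norm (q ^ (T m + T (m + k))) \<le> norm q ^ m * norm q ^ k"
      unfolding norm_power power_add[symmetric] using norm_q by (intro power_decreasing) auto
    have 3: "norm (r (int m) * r (int (k div 2) - 2 * j) * r (int (k - k div 2) + 2 * j)) \<le> C * C * C"
      unfolding norm_mult using \<open>C > 0\<close> by (intro mult_mono C) auto
    have "norm q ^ nat \<bar>j\<bar> * (norm q ^ m * norm q ^ k * (C * C * C)) = h (j, m, k)"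
      by (simp add: h_def power3_eq_cube)
    moreover have "norm ((- 1) powi j * q powi (5 * tri j - 2 * j) *
        (q ^ (T m + T (m + k)) * (r (int m) * r (int (k div 2) - 2 * j) * r (int (k - k div 2) + 2 * j))))
        \<le> norm q ^ nat \<bar>j\<bar> * (norm q ^ m * norm q ^ k * (C * C * C))"
      unfolding norm_mult[of "_ * _" "_ * _"] norm_mult[of "_ ^ _"]
      using 1 2 3 by (intro mult_mono) auto
    ultimately show "norm ((- 1) powi j * q powi (5 * tri j - 2 * j) *
        (q ^ (T m + T (m + k)) * (r (int m) * r (int (k div 2) - 2 * j) * r (int (k - k div 2) + 2 * j)))) \<le> h (j, m, k)"
      by simp
  qed
qed

text \<open>Needed to merge the sum over \<open>n\<close> with the one over \<open>(m, k)\<close>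
  into a single unordered sum. The q-binomials are uniformly bounded because both (q)_n and its
  reciprocal are.\<close>

lemma summable_triple_sum:
  "(\<lambda>((m, k), n). q ^ (T m + T (m + k) + n\<^sup>2) / (qf m * qf k) * q_binomial q (k div 2) n) summable_on UNIV"
proof -
  obtain C where "C > 0" and C: "\<And>k. norm (r k) \<le> C"
    using norm_r_bound by blast
  have "Bseq qf"
    using q_pochhammer_LIMSEQ[OF norm_q] by (intro convergent_imp_Bseq convergentI)
  then obtain K where "K > 0" and K: "\<And>n. norm (qf n) \<le> K"
    by (auto simp: Bseq_def)
  have C': "norm (inverse (qf n)) \<le> C" for n
    using C[of "int n"] by simp
  define D where "D = C * C * (K * (C * C))"
  define h where "h = (\<lambda>((m, k), n). D * (norm q ^ m * norm q ^ k * norm q ^ n))"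
  have "(\<lambda>(m, k). norm q ^ m * norm q ^ k) summable_on UNIV \<times> UNIV"
    by (intro summable_on_times_prod summable_norm_q) auto
  then have "(\<lambda>(x, n). (case x of (m, k) \<Rightarrow> norm q ^ m * norm q ^ k) * norm q ^ n) summable_on UNIV \<times> UNIV"
    by (intro summable_on_times_prod summable_norm_q) auto
  then have h: "h summable_on UNIV"
    unfolding h_def by (auto intro: summable_on_cmult_right simp: case_prod_unfold)
  show ?thesis
  proof (rule abs_summable_summable, rule Infinite_Sum.abs_summable_on_comparison_test'[OF h], clarify)
    fix m k n :: nat
    have "n \<le> n\<^sup>2"
      by (simp add: power2_eq_square)
    then have "m + k + n \<le> T m + T (m + k) + n\<^sup>2"
      using T_ge[of m] T_ge[of "m + k"] by linarith
    then have 1: "norm (q ^ (T m + T (m + k) + n\<^sup>2)) \<le> norm q ^ m * norm q ^ k * norm q ^ n"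
      unfolding norm_power power_add[symmetric] using norm_q by (intro power_decreasing) auto
    have 2: "norm (inverse (qf m) * inverse (qf k)) \<le> C * C"
      unfolding norm_mult using \<open>C > 0\<close> by (intro mult_mono C') auto
    have 3: "norm (q_binomial q (k div 2) n) \<le> K * (C * C)"
    proof (cases "n \<le> k div 2")
      case True
      then have "q_binomial q (k div 2) n = qf (k div 2) * (inverse (qf n) * inverse (qf (k div 2 - n)))"
        by (simp add: q_binomial_def divide_inverse)
      also have "norm \<dots> \<le> K * (C * C)"
        unfolding norm_mult using \<open>C > 0\<close> \<open>K > 0\<close> by (intro mult_mono C' K) auto
      finally show ?thesis .
    qed (use \<open>C > 0\<close> \<open>K > 0\<close> in \<open>simp add: q_binomial_def\<close>)
    have "norm (q ^ (T m + T (m + k) + n\<^sup>2) / (qf m * qf k) * q_binomial q (k div 2) n)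
        = norm (q ^ (T m + T (m + k) + n\<^sup>2)) * (norm (inverse (qf m) * inverse (qf k)) * norm (q_binomial q (k div 2) n))"
      by (simp add: norm_mult norm_divide norm_inverse divide_inverse)
    also have "\<dots> \<le> norm q ^ m * norm q ^ k * norm q ^ n * (C * C * (K * (C * C)))"
      using 1 2 3 \<open>C > 0\<close> by (intro mult_mono) auto
    also have "\<dots> = h ((m, k), n)"
      by (simp add: h_def D_def)
    finally show "norm (q ^ (T m + T (m + k) + n\<^sup>2) / (qf m * qf k) * q_binomial q (k div 2) n) \<le> h ((m, k), n)" .
  qed
qed

text \<open>The triple product with base q^21 and z = q^13: the exponent 21 tri(j-1) + 13j equals 21
  tri(j) - 8j, and base over z is q^8.\<close>

lemma theta_mod_21:
  "((\<lambda>j. (- 1) powi j * q powi (21 * tri j - 8 * j))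
    has_sum q_pochhammer_inf_list [q ^ 21, q ^ 8, q ^ 13] (q ^ 21)) UNIV"
proof -
  interpret Q: q_series "q ^ 21"
    using q_nz norm_q by unfold_locales (auto simp: norm_power power_less_one_iff)
  have e: "(- 1) powi j * (q ^ 21) powi tri (j - 1) * (q ^ 13) powi j = (- 1) powi j * q powi (21 * tri j - 8 * j)" for j
  proof -
    have "21 * tri j - 8 * j = 21 * tri (j - 1) + 13 * j"
      by (simp add: tri_diff)
    then show ?thesis
      by (simp add: power_int_power q_powi_add)
  qed
  have "(\<lambda>j. (- 1) powi j * q powi (21 * tri j - 8 * j)) summable_on UNIV"
  proof (rule abs_summable_summable, rule Infinite_Sum.abs_summable_on_comparison_test'[OF summable_norm_q_abs])
    fix j
    have "\<bar>j\<bar> \<le> 21 * tri j - 8 * j"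
      using tri_ge[of j] tri_nonneg[of j] by linarith
    then have "norm q powi (21 * tri j - 8 * j) \<le> norm q powi \<bar>j\<bar>"
      using norm_q q_nz by (intro power_int_decreasing) auto
    then show "norm ((- 1) powi j * q powi (21 * tri j - 8 * j)) \<le> norm q ^ nat \<bar>j\<bar>"
      by (simp add: norm_mult norm_power_int power_int_nonneg_exp)
  qed
  then have "((\<lambda>j. (- 1) powi j * q powi (21 * tri j - 8 * j)) has_sum
      Q.qinf * q_pochhammer_inf (q ^ 13) (q ^ 21) * q_pochhammer_inf (q ^ 21 / q ^ 13) (q ^ 21)) UNIV"
    using Q.jacobi_triple_product[of "q ^ 13", unfolded e] q_nz by simp
  moreover have "q ^ 21 / q ^ 13 = q ^ 8"
    using q_nz by (simp flip: power_diff)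
  ultimately show ?thesis
    by (simp add: q_pochhammer_inf_list_def mult_ac)
qed

lemma triple_sum:
  "((\<lambda>(m, k, n). q ^ (T m + T (m + k) + n\<^sup>2) / (qf m * qf k) * q_binomial q (k div 2) n)
    has_sum (q_pochhammer_inf_list [q ^ 21, q ^ 8, q ^ 13] (q ^ 21) / qinf)) UNIV"
proof -
  let ?R = "q_pochhammer_inf_list [q ^ 21, q ^ 8, q ^ 13] (q ^ 21) / qinf"
  define c where "c j = (- 1) powi j * q powi (5 * tri j - 2 * j)" for j
  define f where "f j m k = q ^ (T m + T (m + k)) * (r (int m) * r (int (k div 2) - 2 * j) * r (int (k - k div 2) + 2 * j))" for j m k
  have "((\<lambda>(j, (m, k)). c j * f j m k) has_sum ?R) (UNIV \<times> UNIV)"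
  proof (rule has_sum_SigmaI)
    show "((\<lambda>y. case (j, y) of (j, m, k) \<Rightarrow> c j * f j m k) has_sum c j * (q powi tri (4 * j) / qinf)) UNIV" for j
      using has_sum_cmult_right[OF fixed_index_sum[of j], of "c j"] by (simp add: f_def case_prod_unfold)
    have coeff: "c j * (q powi tri (4 * j) / qinf) = (- 1) powi j * q powi (21 * tri j - 8 * j) * inverse qinf" for j
    proof -
      \<comment> \<open>The modulus 21 is 5 + 16, from
        \<open>tri (4 * j) = 16 * tri j - 6 * j\<close>.\<close>
      have e: "21 * tri j - 8 * j = 5 * tri j - 2 * j + tri (4 * j)"
        using two_tri[of "4 * j"] two_tri[of j] by (simp add: algebra_simps)
      show ?thesis
        unfolding e q_powi_add c_def by (simp add: divide_inverse)
    qed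
    show "((\<lambda>j. c j * (q powi tri (4 * j) / qinf)) has_sum ?R) UNIV"
      unfolding coeff unfolding divide_inverse by (rule has_sum_cmult_left[OF theta_mod_21])
    show "(\<lambda>(j, (m, k)). c j * f j m k) summable_on UNIV \<times> UNIV"
      using summable_index_sum by (simp add: c_def f_def)
  qed
  \<comment> \<open>With \<open>j\<close> innermost, Bressoud's identity can be read backwards: for
    fixed \<open>(m, k)\<close> the sum over \<open>j\<close> is a multiple of \<beta>, which the
    sum over \<open>n\<close> also produces.\<close>
  then have swapped: "((\<lambda>(x, j). case x of (m, k) \<Rightarrow> c j * f j m k) has_sum ?R) (UNIV \<times> UNIV)"
    by (subst (asm) has_sum_swap) (simp add: case_prod_unfold)
  have "\<forall>k. \<exists>\<beta>. ((\<lambda>n. q ^ n\<^sup>2 * q_binomial q (k div 2) n) has_sum qf k * \<beta>) UNIV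
      \<and> ((\<lambda>j. c j * (r (int (k div 2) - 2 * j) * r (int (k - k div 2) + 2 * j))) has_sum \<beta>) UNIV"
  proof
    show "\<exists>\<beta>. ((\<lambda>n. q ^ n\<^sup>2 * q_binomial q (k div 2) n) has_sum qf k * \<beta>) UNIV
      \<and> ((\<lambda>j. c j * (r (int (k div 2) - 2 * j) * r (int (k - k div 2) + 2 * j))) has_sum \<beta>) UNIV" for k
      unfolding c_def by (rule bressoud[of k]) blast
  qed
  from choice[OF this] obtain \<beta> where
    \<beta>1: "\<And>k. ((\<lambda>n. q ^ n\<^sup>2 * q_binomial q (k div 2) n) has_sum qf k * \<beta> k) UNIV" and
    \<beta>2: "\<And>k. ((\<lambda>j. c j * (r (int (k div 2) - 2 * j) * r (int (k - k div 2) + 2 * j))) has_sum \<beta> k) UNIV"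
    by blast
  define g where "g = (\<lambda>(m, k). q ^ (T m + T (m + k)) / qf m * \<beta> k)"
  have g: "(g has_sum ?R) UNIV"
  proof (rule has_sum_SigmaD[OF swapped])
    fix x :: "nat \<times> nat"
    obtain m k where x: "x = (m, k)"
      by fastforce
    show "((\<lambda>y. case (x, y) of (x, j) \<Rightarrow> case x of (m, k) \<Rightarrow> c j * f j m k) has_sum g x) UNIV"
      using has_sum_cmult_right[OF \<beta>2[of k], of "q ^ (T m + T (m + k)) / qf m"]
      by (simp add: x g_def f_def divide_inverse mult_ac)
  qed
  have "((\<lambda>((m, k), n). q ^ (T m + T (m + k) + n\<^sup>2) / (qf m * qf k) * q_binomial q (k div 2) n) has_sum ?R) (UNIV \<times> UNIV)"
  proof (rule has_sum_SigmaI[OF _ g])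
    fix x :: "nat \<times> nat"
    obtain m k where x: "x = (m, k)"
      by fastforce
    show "((\<lambda>y. (\<lambda>((m, k), n). q ^ (T m + T (m + k) + n\<^sup>2) / (qf m * qf k) * q_binomial q (k div 2) n) (x, y))
        has_sum g x) UNIV"
      using has_sum_cmult_right[OF \<beta>1[of k], of "q ^ (T m + T (m + k)) / (qf m * qf k)"]
      by (simp add: x g_def power_add mult.assoc)
  qed (use summable_triple_sum in simp)
  also have "?this \<longleftrightarrow> ?thesis"
    by (rule has_sum_reindex_bij_witness[of _ "\<lambda>(m, k, n). ((m, k), n)" "\<lambda>((m, k), n). (m, k, n)"]) auto
  finally show ?thesis .
qed

end

theorem mainTheorem5:
  fixes q :: complex
  assumes "norm q < 1"
  shows "((\<lambda>(m, k, n).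
            q ^ (T m + T (m + k) + n\<^sup>2) / (q_pochhammer q q m * q_pochhammer q q k)
              * q_binomial q (k div 2) n)
          has_sum (q_pochhammer_inf_list [q ^ 21, q ^ 8, q ^ 13] (q ^ 21) / q_pochhammer_inf q q))
         (UNIV :: (nat \<times> nat \<times> nat) set)"
proof (cases "q = 0")
  case True
  \<comment> \<open>Negative powers of q are meaningless at q = 0, so this case is direct: only the
    term at (0, 0, 0) survives, and every product is 1.\<close>
  have inf: "q_pochhammer_inf 0 0 = 1"
    by (simp add: q_pochhammer_inf_def)
  show ?thesis
  proof (rule has_sum_finite_neutralI[of "{(0, 0, 0)}"])
    fix x :: "nat \<times> nat \<times> nat"
    assume "x \<in> UNIV - {(0, 0, 0)}"
    then obtain m k n where x: "x = (m, k, n)" and "m \<noteq> 0 \<or> k \<noteq> 0 \<or> n \<noteq> 0"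
      by (cases x) auto
    then have "T m + T (m + k) + n\<^sup>2 \<noteq> 0"
      using T_ge[of m] T_ge[of "m + k"] by auto
    then show "(\<lambda>(m, k, n). q ^ (T m + T (m + k) + n\<^sup>2) / (q_pochhammer q q m * q_pochhammer q q k)
              * q_binomial q (k div 2) n) x = 0"
      unfolding x True prod.case by (simp only: power_0_left) simp
  qed (auto simp: True inf q_pochhammer_inf_list_def T_def q_binomial_def)
next
  case False
  then interpret q_series q
    using assms by unfold_locales
  show ?thesis
    by (rule triple_sum)
qed

end
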